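(* Let $\mathcal{A}$ be a finite alphabet and $n\ge1$. The $n$-fold interleaving closure operation $X\mapsto X^{[n]}$ on sets $X\subseteq\mathcal{A}^{\mathbb{N}}$ has the following properties. (1) (Projection property) $X^{[n]}$ is characterized by the property that it is the maximal (under inclusion) set $Z\subseteq\mathcal{A}^{\mathbb{N}}$ such that $\psi_{i,n}(Z)=\psi_{i,n}(X)$ for $0\le i\le n-1$. (2) (Extension property) Any set $X\subseteq\mathcal{A}^{\mathbb{N}}$ satisfies $X\subseteq X^{[n]}$. (3) (Idempotent property) $(X^{[n]})^{[n]}=X^{[n]}$ for all $X\subseteq\mathcal{A}^{\mathbb{N}}$. (4) (Isotone property) If $X\subseteq Y$, then $X^{[n]}\subseteq Y^{[n]}$.
   Context: $\mathbb{N}=\{0,1,2,\dots\}$. For $\mathbf{x}=a_0a_1a_2\cdots\in\mathcal{A}^{\mathbb{N}}$, $i\ge0$, $n\ge1$, the decimation is $\psi_{i,n}(\mathbf{x})=a_ia_{i+n}a_{i+2n}\cdots$, and $\psi_{i,n}(X)=\{\psi_{i,n}(\mathbf{x}):\mathbf{x}\in X\}$. The $n$-fold interleaving of sequences $\mathbf{x}_i=a_{i,0}a_{i,1}\cdots$ ($0\le i\le n-1$) is $b_0b_1b_2\cdots$ with $b_{i+jn}=a_{i,j}$ ($0\le i\le n-1$, $j\ge0$); the $n$-fold interleaving $(\circledast_n)_{i=0}^{n-1}X_i$ of sets is the set of all $n$-fold interleavings of $(\mathbf{x}_0,\dots,\mathbf{x}_{n-1})$ with $\mathbf{x}_i\in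 X_i$. The $n$-fold interleaving closure of $X$ is $X^{[n]}=(\circledast_n)_{i=0}^{n-1}\psi_{i,n}(X)$. In (1), "the maximal set" means the largest one: it has the property and contains every set having the property. *)

theory Defs
  imports Main "HOL-Library.FuncSet"
begin

definition sequences :: "'a set \<Rightarrow> (nat \<Rightarrow> 'a) set" where
  "sequences A = (UNIV \<rightarrow> A)"

definition decimation :: "nat \<Rightarrow> nat \<Rightarrow> (nat \<Rightarrow> 'a) \<Rightarrow> (nat \<Rightarrow> 'a)" where
  "decimation i n x = (\<lambda>j. x (i + j * n))"

text \<open>Only the first \<open>n\<close> members of the family \<open>xs\<close> matter. For \<open>n \<ge> 1\<close> every index is
  uniquely of the form \<open>i + j * n\<close> with \<open>i < n\<close>, namely with \<open>i = k mod n\<close> and \<open>j = k div n\<close>.\<close>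

definition interleave :: "nat \<Rightarrow> (nat \<Rightarrow> nat \<Rightarrow> 'a) \<Rightarrow> (nat \<Rightarrow> 'a)" where
  "interleave n xs = (\<lambda>k. xs (k mod n) (k div n))"

lemma interleave_index:
  assumes "i < n"
  shows "interleave n xs (i + j * n) = xs i j"
  using assms by (simp add: interleave_def)

definition interleave_sets :: "nat \<Rightarrow> (nat \<Rightarrow> (nat \<Rightarrow> 'a) set) \<Rightarrow> (nat \<Rightarrow> 'a) set" where
  "interleave_sets n Xs = {interleave n xs | xs. \<forall>i<n. xs i \<in> Xs i}"

definition interleaving_closure :: "nat \<Rightarrow> (nat \<Rightarrow> 'a) set \<Rightarrow> (nat \<Rightarrow> 'a) set" where
  "interleaving_closure n X = interleave_sets n (\<lambda>i. decimation i n ` X)"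

definition is_largest_set :: "('b set \<Rightarrow> bool) \<Rightarrow> 'b set \<Rightarrow> bool" where
  "is_largest_set P Z \<longleftrightarrow> P Z \<and> (\<forall>W. P W \<longrightarrow> W \<subseteq> Z)"

end

theory Submission
  imports Defs
begin

text \<open>For \<open>n \<ge> 1\<close> a sequence is determined by its \<open>n\<close> decimations, and these can be prescribed
  independently. Hence \<open>z\<close> lies in the closure of \<open>X\<close> iff each decimation of \<open>z\<close> is a decimation
  of some element of \<open>X\<close>; all four properties are read off this membership criterion.\<close>

lemma decimation_interleave:
  assumes "i < n"
  shows "decimation i n (interleave n xs) = xs i"
  using assms by (simp add: decimation_def interleave_index)

text \<open>Division with remainder: the entry at \<open>k\<close> is read from \<open>z\<close> at
  \<open>k mod n + k div n * n = k\<close>.\<close>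

lemma interleave_decimation: "interleave n (\<lambda>i. decimation i n z) = z"
  by (simp add: interleave_def decimation_def)

lemma mem_interleaving_closure_iff:
  "z \<in> interleaving_closure n X \<longleftrightarrow> (\<forall>i<n. decimation i n z \<in> decimation i n ` X)"
proof
  assume "z \<in> interleaving_closure n X"
  then show "\<forall>i<n. decimation i n z \<in> decimation i n ` X"
    by (auto simp: interleaving_closure_def interleave_sets_def decimation_interleave)
next
  assume "\<forall>i<n. decimation i n z \<in> decimation i n ` X"
  then show "z \<in> interleaving_closure n X"
    unfolding interleaving_closure_def interleave_sets_def
    \<comment> \<open>The witness is the family of decimations of \<open>z\<close> itself, which
      interleaves back to \<open>z\<close>.\<close>
    by (intro CollectI exI[of _ "\<lambda>i. decimation i n z"]) (simp add: interleave_decimation)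
qed

lemma interleaving_closure_extensive: "X \<subseteq> interleaving_closure n X"
  by (auto simp: mem_interleaving_closure_iff)

lemma interleaving_closure_mono:
  assumes "X \<subseteq> Y"
  shows "interleaving_closure n X \<subseteq> interleaving_closure n Y"
  using assms by (fastforce simp: mem_interleaving_closure_iff)

text \<open>One inclusion is the membership criterion, the other is extensivity.\<close>

lemma decimation_interleaving_closure:
  assumes "i < n"
  shows "decimation i n ` interleaving_closure n X = decimation i n ` X"
  using assms interleaving_closure_extensive[of X n]
  by (auto simp: mem_interleaving_closure_iff)

text \<open>The membership criterion sees \<open>X\<close> only through its decimation images, and
  the closure preserves these.\<close>

lemma interleaving_closure_idem:
  "interleaving_closure n (interleaving_closure n X) = interleaving_closure n X"
  by (auto simp: mem_interleaving_closure_iff decimation_interleaving_closure)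

text \<open>Makes the closure itself a candidate in the maximality property. For
  \<open>n = 0\<close> the membership criterion is vacuous and the closure would be
  \<open>UNIV\<close>.\<close>

lemma interleaving_closure_subset_sequences:
  assumes "n \<ge> 1" and "X \<subseteq> sequences A"
  shows "interleaving_closure n X \<subseteq> sequences A"
proof
  fix z
  assume z: "z \<in> interleaving_closure n X"
  have "z k \<in> A" for k
  proof -
    have "k mod n < n"
      using assms(1) by simp
    then obtain x where "x \<in> X" and "decimation (k mod n) n z = decimation (k mod n) n x"
      using z by (auto simp: mem_interleaving_closure_iff)
    \<comment> \<open>Position \<open>k\<close> is entry \<open>k div n\<close> of decimation
      \<open>k mod n\<close>. The element \<open>x\<close> may vary with \<open>k\<close>, which is
      harmless since only membership in \<open>A\<close> is claimed.\<close>
    then have "z k = x k"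
      by (auto simp: decimation_def dest: fun_cong[of _ _ "k div n"])
    then show ?thesis
      using \<open>x \<in> X\<close> assms(2) by (auto simp: sequences_def)
  qed
  then show "z \<in> sequences A"
    by (simp add: sequences_def)
qed

text \<open>By antisymmetry of inclusion a largest set is unique, so exhibiting one gives the full
  characterization.\<close>

lemma is_largest_set_iff_eq:
  assumes "is_largest_set P Z"
  shows "is_largest_set P W \<longleftrightarrow> W = Z"
  using assms by (auto simp: is_largest_set_def)

lemma is_largest_set_interleaving_closure:
  assumes "n \<ge> 1" and "X \<subseteq> sequences A"
  shows "is_largest_set
    (\<lambda>W. W \<subseteq> sequences A \<and> (\<forall>i<n. decimation i n ` W = decimation i n ` X))
    (interleaving_closure n X)"
  unfolding is_largest_set_def
proof (intro conjI allI impI)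
  show "interleaving_closure n X \<subseteq> sequences A"
    using assms by (rule interleaving_closure_subset_sequences)
next
  fix i
  assume "i < n"
  then show "decimation i n ` interleaving_closure n X = decimation i n ` X"
    by (rule decimation_interleaving_closure)
next
  fix W
  assume "W \<subseteq> sequences A \<and> (\<forall>i<n. decimation i n ` W = decimation i n ` X)"
  then show "W \<subseteq> interleaving_closure n X"
    \<comment> \<open>Each decimation of an element of \<open>W\<close> lies in the decimation image
      of \<open>W\<close>, which equals that of \<open>X\<close>, so the membership criterion
      applies.\<close>
    by (metis imageI mem_interleaving_closure_iff subsetI)
qed

theorem theorem4p2:
  fixes A :: "'a set" and n :: nat
  assumes "finite A" and "n \<ge> 1"
  shows "(\<forall>X. X \<subseteq> sequences A \<longrightarrow>
            (\<forall>Z. is_largest_set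
                    (\<lambda>W. W \<subseteq> sequences A \<and>
                         (\<forall>i<n. decimation i n ` W = decimation i n ` X)) Z
                 \<longleftrightarrow> Z = interleaving_closure n X))
       \<and> (\<forall>X. X \<subseteq> sequences A \<longrightarrow> X \<subseteq> interleaving_closure n X)
       \<and> (\<forall>X. X \<subseteq> sequences A \<longrightarrow>
            interleaving_closure n (interleaving_closure n X) = interleaving_closure n X)
       \<and> (\<forall>X Y. X \<subseteq> sequences A \<longrightarrow> Y \<subseteq> sequences A \<longrightarrow> X \<subseteq> Y \<longrightarrow>
            interleaving_closure n X \<subseteq> interleaving_closure n Y)"
proof (intro conjI allI impI)
  fix X Z :: "(nat \<Rightarrow> 'a) set"
  assume "X \<subseteq> sequences A"
  then show "is_largest_set
      (\<lambda>W. W \<subseteq> sequences A \<and> (\<forall>i<n. decimation i n ` W = decimation i n ` X)) Z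
    \<longleftrightarrow> Z = interleaving_closure n X"
    using assms(2) by (intro is_largest_set_iff_eq is_largest_set_interleaving_closure)
qed (simp_all add: interleaving_closure_extensive interleaving_closure_idem
    interleaving_closure_mono)

end
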